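(* Let $G$ be a reduced abelian group. If $G$ is strongly co-Hopfian, then $G$ is strongly Hopfian. If $G$ is uniformly strongly co-Hopfian, then $G$ is uniformly strongly Hopfian.
   Context: All groups are abelian and written additively. $\mathbb N$ denotes the positive integers. A group $G$ is strongly Hopfian (SH) if for every endomorphism $\phi$ of $G$ there is $n\in\mathbb N$ such that $\phi$ restricted to $\phi^n(G)$ is injective (equivalently, $\ker\phi^n=\ker\phi^m$ for all $m\ge n$); such an $n$ is called an SH-exponent for $\phi$. $G$ is uniformly SH if a single $n\in\mathbb N$ is an SH-exponent for all endomorphisms of $G$. $G$ is strongly co-Hopfian (Sco-H) if for every endomorphism $\phi$ of $G$ there is $n\in\mathbb N$ with $\phi^n(G)=\phi^m(G)$ for all $m\ge n$; it is uniformly Sco-H if a single $n$ works for all endomorphisms of $G$. A group is reduced if it has no nonzero divisible subgroup. *)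

theory Defs
  imports "HOL-Algebra.Group"
begin

(* Abelian groups are HOL-Algebra's comm_group, written multiplicatively: the integer
   multiple n x is x [^] n, and endomorphisms are the elements of hom G G. *)

definition divisible_subgroup :: "'a set \<Rightarrow> ('a, 'b) monoid_scheme \<Rightarrow> bool" where
  "divisible_subgroup D G \<longleftrightarrow>
     subgroup D G \<and> (\<forall>n::nat. n > 0 \<longrightarrow> (\<forall>x\<in>D. \<exists>y\<in>D. y [^]\<^bsub>G\<^esub> n = x))"

definition reduced_group :: "('a, 'b) monoid_scheme \<Rightarrow> bool" where
  "reduced_group G \<longleftrightarrow> (\<forall>D. divisible_subgroup D G \<longrightarrow> D = {\<one>\<^bsub>G\<^esub>})"

(* Exponents are positive integers. *)

definition SH_exponent :: "('a, 'b) monoid_scheme \<Rightarrow> ('a \<Rightarrow> 'a) \<Rightarrow> nat \<Rightarrow> bool" where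
  "SH_exponent G \<phi> n \<longleftrightarrow> n > 0 \<and> inj_on \<phi> ((\<phi> ^^ n) ` carrier G)"

definition strongly_Hopfian :: "('a, 'b) monoid_scheme \<Rightarrow> bool" where
  "strongly_Hopfian G \<longleftrightarrow> (\<forall>\<phi>\<in>hom G G. \<exists>n. SH_exponent G \<phi> n)"

definition uniformly_strongly_Hopfian :: "('a, 'b) monoid_scheme \<Rightarrow> bool" where
  "uniformly_strongly_Hopfian G \<longleftrightarrow> (\<exists>n. \<forall>\<phi>\<in>hom G G. SH_exponent G \<phi> n)"

definition ScoH_exponent :: "('a, 'b) monoid_scheme \<Rightarrow> ('a \<Rightarrow> 'a) \<Rightarrow> nat \<Rightarrow> bool" where
  "ScoH_exponent G \<phi> n \<longleftrightarrow>
     n > 0 \<and> (\<forall>m\<ge>n. (\<phi> ^^ n) ` carrier G = (\<phi> ^^ m) ` carrier G)"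

definition strongly_co_Hopfian :: "('a, 'b) monoid_scheme \<Rightarrow> bool" where
  "strongly_co_Hopfian G \<longleftrightarrow> (\<forall>\<phi>\<in>hom G G. \<exists>n. ScoH_exponent G \<phi> n)"

definition uniformly_strongly_co_Hopfian :: "('a, 'b) monoid_scheme \<Rightarrow> bool" where
  "uniformly_strongly_co_Hopfian G \<longleftrightarrow> (\<exists>n. \<forall>\<phi>\<in>hom G G. ScoH_exponent G \<phi> n)"

end

theory Submission
  imports Defs "HOL-Algebra.FiniteProduct" "HOL-Algebra.Generated_Groups"
    "HOL-Computational_Algebra.Polynomial" "HOL-Computational_Algebra.Primes"
begin

text \<open>
  In a reduced strongly co-Hopfian group \<open>G\<close>, every strongly co-Hopfian exponent \<open>n\<close> of an
  endomorphism \<open>\<phi>\<close> is also a strongly Hopfian exponent of it (\<open>ScoH_exponent_imp_SH_exponent\<close>);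
  this gives both the plain and the uniform assertion. These explanations use additive language,
  so that \<open>x [^] q\<close> is the multiple \<open>q x\<close>.

  Reduction to one prime. Multiplication by a prime \<open>p\<close> is an endomorphism, so the chain of the
  \<open>p ^ j G\<close> becomes constant at some \<open>j = k\<close>. The \<open>p\<close>-torsion of \<open>p ^ k G\<close> is divisible, hence zero
  since \<open>G\<close> is reduced. Therefore \<open>G\<close> is the direct sum of its \<open>p ^ k\<close>-torsion and \<open>p ^ k G\<close>, and
  the projection \<open>\<pi>\<close> to the torsion summand commutes with all endomorphisms
  (\<open>exists_torsion_projection\<close>). If \<open>\<phi>\<close> is injective on \<open>\<pi> (\<phi> ^^ n G)\<close> for every \<open>p\<close>, then an element
  of \<open>\<phi> ^^ n G\<close> killed by \<open>\<phi>\<close> lies in \<open>p ^ j G\<close> for all \<open>p\<close> and \<open>j\<close>. The elements with that property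
  form a divisible subgroup, which is zero (\<open>reduced_common_prime_powers_trivial\<close>).

  Bounded \<open>p\<close>-groups. The group \<open>H = \<pi> (\<phi> ^^ n G)\<close> is killed by \<open>p ^ k\<close> and \<open>\<phi>\<close> maps it onto itself.
  Suppose that \<open>\<phi>\<close> is not injective on \<open>H\<close>. Choose \<open>d\<close> such that \<open>\<phi>\<close> is injective on \<open>p ^ (d + 1) H\<close>
  but not on \<open>p ^ d H\<close>, choose \<open>e 0\<close> with \<open>p ^ d (e 0)\<close> a nonzero element of the kernel, and lift
  successively: \<open>\<phi> (e (i + 1)) = e i\<close>. Then all \<open>e i\<close> have order \<open>p ^ (d + 1)\<close> and they are independent
  modulo \<open>p ^ (d + 1) H\<close> (\<open>exists_lift_chain\<close>, \<open>pure_independent\<close>). Hence a Zorn argument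
  (\<open>extend_partial_hom\<close>) produces an endomorphism \<open>g\<close> of \<open>H\<close>, with values in the span of the \<open>e i\<close>,
  \<open>i > n\<close>, such that \<open>g (e i) = e (i + n + 1)\<close>. The composition of \<open>g\<close> with \<open>\<phi> ^^ n\<close> shifts \<open>e i\<close> to
  \<open>e (i + 1)\<close> for \<open>i \<ge> n\<close>, so its iterated images never become stationary
  (\<open>exists_endomorphism_unstable_images\<close>). Because \<open>\<phi> ^^ n\<close> maps \<open>\<pi> G\<close> onto \<open>H\<close>, the endomorphism
  \<open>g \<circ> \<phi> ^^ n \<circ> \<pi>\<close> of \<open>G\<close> has the same images, against strong co-Hopficity
  (\<open>stable_image_torsion_injective\<close>).
\<close>

section \<open>Integer combinations of a sequence of group elements\<close>

text \<open>
  The combination of the \<open>e i\<close> with the coefficients of the integer polynomial \<open>f\<close>. Polynomials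
  serve as finitely supported sequences of integers; multiplication by a power of the
  indeterminate shifts the sequence.
\<close>
definition lincomb :: "('a, 'b) monoid_scheme \<Rightarrow> (nat \<Rightarrow> 'a) \<Rightarrow> int poly \<Rightarrow> 'a" where
  "lincomb G e f = finprod G (\<lambda>i. e i [^]\<^bsub>G\<^esub> coeff f i) {..degree f}"

context comm_group
begin

lemma lincomb_eq_finprod:
  assumes "range e \<subseteq> carrier G" and "degree f \<le> d"
  shows "lincomb G e f = finprod G (\<lambda>i. e i [^] coeff f i) {..d}"
  unfolding lincomb_def using assms
  by (intro finprod_mono_neutral_cong_left) (auto simp: coeff_eq_0)

lemma lincomb_closed [simp]: "range e \<subseteq> carrier G \<Longrightarrow> lincomb G e f \<in> carrier G"
  unfolding lincomb_def by (rule finprod_closed) auto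

lemma lincomb_zero [simp]: "range e \<subseteq> carrier G \<Longrightarrow> lincomb G e 0 = \<one>"
  unfolding lincomb_def by (auto simp: Pi_iff)

lemma lincomb_pCons:
  assumes "range e \<subseteq> carrier G"
  shows "lincomb G e (pCons a f) = e 0 [^] a \<otimes> lincomb G (\<lambda>i. e (Suc i)) f"
proof -
  have "lincomb G e (pCons a f)
      = finprod G (\<lambda>i. e i [^] coeff (pCons a f) i) {..Suc (degree f)}"
    by (rule lincomb_eq_finprod[OF assms]) (rule degree_pCons_le)
  also have "\<dots> = finprod G (\<lambda>i. e (Suc i) [^] coeff f i) {..degree f} \<otimes> e 0 [^] a"
    by (subst finprod_Suc2) (use assms in auto)
  finally show ?thesis
    using assms by (simp add: lincomb_def m_comm Pi_iff image_subset_iff)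
qed

lemma lincomb_add:
  assumes "range e \<subseteq> carrier G"
  shows "lincomb G e (f + g) = lincomb G e f \<otimes> lincomb G e g"
proof -
  let ?d = "max (degree f) (degree g)"
  have "lincomb G e (f + g) = finprod G (\<lambda>i. e i [^] coeff (f + g) i) {..?d}"
    by (rule lincomb_eq_finprod[OF assms degree_add_le_max])
  also have "\<dots> = finprod G (\<lambda>i. e i [^] coeff f i \<otimes> e i [^] coeff g i) {..?d}"
    by (rule finprod_cong) (use assms in \<open>auto simp: int_pow_mult image_subset_iff simp_implies_def\<close>)
  also have "\<dots> = finprod G (\<lambda>i. e i [^] coeff f i) {..?d} \<otimes> finprod G (\<lambda>i. e i [^] coeff g i) {..?d}"
    by (rule finprod_multf) (use assms in auto)
  finally show ?thesis
    using assms by (simp add: lincomb_eq_finprod[of e _ ?d])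
qed

lemma lincomb_smult:
  assumes "range e \<subseteq> carrier G"
  shows "lincomb G e (smult c f) = lincomb G e f [^] c"
  using assms
proof (induction f arbitrary: e)
  case (pCons a f)
  have "range (\<lambda>i. e (Suc i)) \<subseteq> carrier G" using pCons.prems by auto
  then show ?case using pCons.prems
    by (auto simp: lincomb_pCons int_pow_distrib int_pow_pow mult.commute pCons.IH image_subset_iff)
qed simp

lemma lincomb_uminus:
  assumes "range e \<subseteq> carrier G"
  shows "lincomb G e (- f) = inv (lincomb G e f)"
  using lincomb_smult[OF assms, of "-1" f] assms by (simp add: int_pow_neg)

lemma hom_lincomb:
  assumes h: "h \<in> hom G G" and "range e \<subseteq> carrier G"
  shows "h (lincomb G e f) = lincomb G (\<lambda>i. h (e i)) f"
  using assms(2)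
proof (induction f arbitrary: e)
  case 0
  then have "range (\<lambda>i. h (e i)) \<subseteq> carrier G" using h by (auto simp: hom_def)
  then show ?case using 0 hom_one[OF h is_group is_group] by simp
next
  case (pCons a f)
  have *: "range (\<lambda>i. e (Suc i)) \<subseteq> carrier G" using pCons.prems by auto
  have **: "range (\<lambda>i. h (e i)) \<subseteq> carrier G" using h pCons.prems by (auto simp: hom_def)
  have e0: "e 0 \<in> carrier G" using pCons.prems by auto
  have "h (lincomb G e (pCons a f)) = h (e 0 [^] a) \<otimes> h (lincomb G (\<lambda>i. e (Suc i)) f)"
    using * e0 pCons.prems by (simp add: lincomb_pCons hom_mult[OF h])
  also have "h (e 0 [^] a) = h (e 0) [^] a"
    by (rule hom_int_pow[OF h e0 is_group is_group])
  finally show ?case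
    using ** by (simp add: lincomb_pCons pCons.IH[OF *])
qed

end

section \<open>Extension of homomorphisms\<close>

text \<open>
  Homomorphisms from subgroups of \<open>G\<close> to \<open>C\<close>, encoded by their graphs: subgroups of the direct
  product in which only the neutral element is related to the neutral element.
\<close>
definition partial_homs ::
    "('a, 'b) monoid_scheme \<Rightarrow> ('c, 'd) monoid_scheme \<Rightarrow> ('a \<times> 'c) set set" where
  "partial_homs G C = {F. subgroup F (G \<times>\<times> C) \<and> (\<forall>c. (\<one>\<^bsub>G\<^esub>, c) \<in> F \<longrightarrow> c = \<one>\<^bsub>C\<^esub>)}"

lemma (in group) subgroup_Union_chain:
  assumes "\<C> \<noteq> {}" and ch: "subset.chain \<A> \<C>"
    and sub: "\<And>F. F \<in> \<A> \<Longrightarrow> subgroup F G"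
  shows "subgroup (\<Union>\<C>) G"
proof -
  have sub': "subgroup F G" if "F \<in> \<C>" for F
    using ch sub that by (auto simp: subset.chain_def)
  show ?thesis
  proof (rule subgroupI)
    show "\<Union>\<C> \<subseteq> carrier G" using sub' subgroup.subset by blast
    show "\<Union>\<C> \<noteq> {}" using assms(1) sub' subgroup.one_closed by fastforce
    show "inv a \<in> \<Union>\<C>" if "a \<in> \<Union>\<C>" for a
      using that sub' subgroup.m_inv_closed by fast
    show "a \<otimes> b \<in> \<Union>\<C>" if a: "a \<in> \<Union>\<C>" and b: "b \<in> \<Union>\<C>" for a b
    proof -
      obtain A B where AB: "A \<in> \<C>" "B \<in> \<C>" "a \<in> A" "b \<in> B" using a b by blast
      then have "A \<subseteq> B \<or> B \<subseteq> A" using ch by (auto simp: subset.chain_def)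
      then show ?thesis using AB sub' subgroup.m_closed by (metis UnionI subsetD)
    qed
  qed
qed

text \<open>
  A partial homomorphism whose domain contains \<open>p ^ (d + 1) G\<close> and which vanishes there extends
  to \<open>G\<close> if in the target every element killed by \<open>p ^ d\<close> is divisible by \<open>p\<close>. The condition on
  the target is Baer's criterion: a maximal extension with domain \<open>D\<close> can be enlarged by any
  \<open>a\<close> with \<open>p a\<close> in \<open>D\<close>.
\<close>
lemma extend_partial_hom:
  fixes p :: int and d :: nat
  assumes G: "comm_group G" and C: "comm_group C" and p: "prime p"
    and F0: "F0 \<in> partial_homs G C"
    and pow: "\<And>y. y \<in> carrier G \<Longrightarrow> (y [^]\<^bsub>G\<^esub> p ^ Suc d, \<one>\<^bsub>C\<^esub>) \<in> F0"
    and root: "\<And>c. c \<in> carrier C \<Longrightarrow> c [^]\<^bsub>C\<^esub> p ^ d = \<one>\<^bsub>C\<^esub> \<Longrightarrow> \<exists>b\<in>carrier C. c = b [^]\<^bsub>C\<^esub> p"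
  shows "\<exists>g\<in>hom G C. \<forall>(x, y)\<in>F0. g x = y"
proof -
  interpret G: comm_group G by fact
  interpret C: comm_group C by fact
  interpret P: group "G \<times>\<times> C" by (rule DirProd_group) unfold_locales
  let ?\<A> = "{F \<in> partial_homs G C. F0 \<subseteq> F}"
  have "\<exists>M\<in>?\<A>. \<forall>X\<in>?\<A>. M \<subseteq> X \<longrightarrow> X = M"
  proof (rule subset_Zorn_nonempty)
    show "?\<A> \<noteq> {}" using F0 by blast
    fix \<C> assume "\<C> \<noteq> {}" and ch: "subset.chain ?\<A> \<C>"
    then have "subgroup (\<Union>\<C>) (G \<times>\<times> C)"
      by (intro P.subgroup_Union_chain) (auto simp: partial_homs_def)
    then show "\<Union>\<C> \<in> ?\<A>"
      using \<open>\<C> \<noteq> {}\<close> ch by (auto simp: partial_homs_def subset.chain_def)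
  qed
  then obtain M where M: "subgroup M (G \<times>\<times> C)" "\<And>c. (\<one>\<^bsub>G\<^esub>, c) \<in> M \<Longrightarrow> c = \<one>\<^bsub>C\<^esub>" "F0 \<subseteq> M"
    and maxM: "\<And>X. X \<in> partial_homs G C \<Longrightarrow> M \<subseteq> X \<Longrightarrow> X = M"
    by (auto simp: partial_homs_def)
  interpret M: subgroup M "G \<times>\<times> C" by fact
  have M_carr: "x \<in> carrier G" "y \<in> carrier C" if "(x, y) \<in> M" for x y
    using M.subset that by auto
  have M_mult: "(x \<otimes>\<^bsub>G\<^esub> x', y \<otimes>\<^bsub>C\<^esub> y') \<in> M" if "(x, y) \<in> M" "(x', y') \<in> M" for x y x' y'
    using M.m_closed[OF that] by simp
  have M_inv: "(inv\<^bsub>G\<^esub> x, inv\<^bsub>C\<^esub> y) \<in> M" if "(x, y) \<in> M" for x y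
    using M.m_inv_closed[OF that] M_carr[OF that] by (simp)
  have M_npow: "(x [^]\<^bsub>G\<^esub> n, y [^]\<^bsub>C\<^esub> n) \<in> M" if "(x, y) \<in> M" for x y and n :: nat
  proof (induction n)
    case 0
    then show ?case using M.one_closed by simp
  next
    case (Suc n)
    then show ?case using M_mult[OF _ that] by simp
  qed
  have M_pow: "(x [^]\<^bsub>G\<^esub> n, y [^]\<^bsub>C\<^esub> n) \<in> M" if "(x, y) \<in> M" for x y and n :: int
    
  proof (cases "n < 0")
    case True
    then show ?thesis using M_inv[OF M_npow[OF that, of "nat (- n)"]]
      by (simp only: int_pow_def2 if_True)
  next
    case False
    then show ?thesis using M_npow[OF that, of "nat n"]
      by (simp only: int_pow_def2 if_False)
  qed
  have M_fun: "y = y'" if "(x, y) \<in> M" "(x, y') \<in> M" for x y y'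
  proof -
    have "(\<one>\<^bsub>G\<^esub>, y \<otimes>\<^bsub>C\<^esub> inv\<^bsub>C\<^esub> y') \<in> M"
      using M_mult[OF that(1) M_inv[OF that(2)]] M_carr[OF that(1)] by simp
    then show ?thesis
      using M(2) M_carr that C.inv_equality C.inv_inv C.inv_closed by metis
  qed
  have dom_p: "a \<in> Domain M" if a: "a \<in> carrier G" and ap: "a [^]\<^bsub>G\<^esub> p \<in> Domain M" for a
  proof (rule ccontr)
    assume na: "a \<notin> Domain M"
    obtain c where c: "(a [^]\<^bsub>G\<^esub> p, c) \<in> M" using ap by blast
    have "(a [^]\<^bsub>G\<^esub> p ^ Suc d, c [^]\<^bsub>C\<^esub> p ^ d) \<in> M"
      using M_pow[OF c, of "p ^ d"] a by (simp add: G.int_pow_pow)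
    then have "c [^]\<^bsub>C\<^esub> p ^ d = \<one>\<^bsub>C\<^esub>"
      using M_fun pow[OF a] M(3) by blast
    then obtain b where b: "b \<in> carrier C" "c = b [^]\<^bsub>C\<^esub> p"
      using root M_carr[OF c] by blast
    \<comment> \<open>Enlarge \<open>M\<close> by sending \<open>a\<close> to a \<open>p\<close>-th root \<open>b\<close> of the image \<open>c\<close> of its \<open>p\<close>-th power.\<close>
    define F where
      "F = {(x \<otimes>\<^bsub>G\<^esub> a [^]\<^bsub>G\<^esub> (r::int), y \<otimes>\<^bsub>C\<^esub> b [^]\<^bsub>C\<^esub> r) | x y r. (x, y) \<in> M}"
    have F_I: "(x \<otimes>\<^bsub>G\<^esub> a [^]\<^bsub>G\<^esub> r, y \<otimes>\<^bsub>C\<^esub> b [^]\<^bsub>C\<^esub> r) \<in> F" if "(x, y) \<in> M" for x y and r :: int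
      using that by (auto simp: F_def)
    have "subgroup F (G \<times>\<times> C)"
    proof (rule P.subgroupI)
      show "F \<subseteq> carrier (G \<times>\<times> C)" using a b M_carr by (auto simp: F_def)
      show "F \<noteq> {}" using F_I[OF c] by blast
      fix u assume "u \<in> F"
      then obtain x y and r :: int where
        u: "u = (x \<otimes>\<^bsub>G\<^esub> a [^]\<^bsub>G\<^esub> r, y \<otimes>\<^bsub>C\<^esub> b [^]\<^bsub>C\<^esub> r)" and xy: "(x, y) \<in> M"
        unfolding F_def by blast
      have "inv\<^bsub>G \<times>\<times> C\<^esub> u = (inv\<^bsub>G\<^esub> x \<otimes>\<^bsub>G\<^esub> a [^]\<^bsub>G\<^esub> (-r), inv\<^bsub>C\<^esub> y \<otimes>\<^bsub>C\<^esub> b [^]\<^bsub>C\<^esub> (-r))"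
        using a b M_carr[OF xy] unfolding u
        by (subst inv_DirProd) (auto simp: G.inv_mult C.inv_mult G.int_pow_neg C.int_pow_neg)
      then show "inv\<^bsub>G \<times>\<times> C\<^esub> u \<in> F" using F_I[OF M_inv[OF xy]] by simp
      fix v assume "v \<in> F"
      then obtain x' y' and s :: int where
        v: "v = (x' \<otimes>\<^bsub>G\<^esub> a [^]\<^bsub>G\<^esub> s, y' \<otimes>\<^bsub>C\<^esub> b [^]\<^bsub>C\<^esub> s)" and xy': "(x', y') \<in> M"
        unfolding F_def by blast
      have "u \<otimes>\<^bsub>G \<times>\<times> C\<^esub> v = ((x \<otimes>\<^bsub>G\<^esub> x') \<otimes>\<^bsub>G\<^esub> a [^]\<^bsub>G\<^esub> (r + s), (y \<otimes>\<^bsub>C\<^esub> y') \<otimes>\<^bsub>C\<^esub> b [^]\<^bsub>C\<^esub> (r + s))"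
        unfolding u v using a b M_carr[OF xy] M_carr[OF xy']
        by (simp add: G.int_pow_mult C.int_pow_mult G.m_ac C.m_ac)
      then show "u \<otimes>\<^bsub>G \<times>\<times> C\<^esub> v \<in> F" using F_I[OF M_mult[OF xy xy']] by simp
    qed
    moreover have "z = \<one>\<^bsub>C\<^esub>" if oz: "(\<one>\<^bsub>G\<^esub>, z) \<in> F" for z
    proof -
      obtain x y and r :: int where
        eq: "\<one>\<^bsub>G\<^esub> = x \<otimes>\<^bsub>G\<^esub> a [^]\<^bsub>G\<^esub> r" and z: "z = y \<otimes>\<^bsub>C\<^esub> b [^]\<^bsub>C\<^esub> r" and xy: "(x, y) \<in> M"
        using oz unfolding F_def by blast
      have ar: "a [^]\<^bsub>G\<^esub> r = inv\<^bsub>G\<^esub> x"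
        using eq a M_carr[OF xy] by (metis G.int_pow_closed G.inv_equality G.m_comm)
      then have dr: "(a [^]\<^bsub>G\<^esub> r, inv\<^bsub>C\<^esub> y) \<in> M" using M_inv[OF xy] by simp
      \<comment> \<open>Otherwise a Bezout relation between \<open>p\<close> and \<open>r\<close> puts \<open>a\<close> itself into the domain.\<close>
      have "p dvd r"
      proof (rule ccontr)
        assume "\<not> p dvd r"
        then have "coprime p r" using p prime_imp_coprime by blast
        then obtain u v where uv: "u * p + v * r = 1"
          by (metis bezout_int coprime_imp_gcd_eq_1)
        have "((a [^]\<^bsub>G\<^esub> p) [^]\<^bsub>G\<^esub> u \<otimes>\<^bsub>G\<^esub> (a [^]\<^bsub>G\<^esub> r) [^]\<^bsub>G\<^esub> v, c [^]\<^bsub>C\<^esub> u \<otimes>\<^bsub>C\<^esub> (inv\<^bsub>C\<^esub> y) [^]\<^bsub>C\<^esub> v) \<in> M"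
          by (intro M_mult M_pow c dr)
        moreover have "(a [^]\<^bsub>G\<^esub> p) [^]\<^bsub>G\<^esub> u \<otimes>\<^bsub>G\<^esub> (a [^]\<^bsub>G\<^esub> r) [^]\<^bsub>G\<^esub> v = a"
          using a uv by (simp add: G.int_pow_pow G.int_pow_mult[symmetric] mult.commute)
        ultimately show False using na by auto
      qed
      then obtain s where s: "r = p * s" ..
      have "(a [^]\<^bsub>G\<^esub> r, b [^]\<^bsub>C\<^esub> r) \<in> M"
        using M_pow[OF c, of s] a b by (simp add: s G.int_pow_pow C.int_pow_pow)
      then have "b [^]\<^bsub>C\<^esub> r = inv\<^bsub>C\<^esub> y" using M_fun dr by blast
      then show ?thesis using z M_carr[OF xy] by simp
    qed
    ultimately have "F \<in> partial_homs G C" by (auto simp: partial_homs_def)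
    moreover have "M \<subseteq> F"
    proof
      fix u assume "u \<in> M"
      then show "u \<in> F" using F_I[of "fst u" "snd u" 0] M_carr[of "fst u" "snd u"] by auto
    qed
    ultimately have "F = M" by (rule maxM)
    moreover have "(a, b) \<in> F"
      using F_I[of "\<one>\<^bsub>G\<^esub>" "\<one>\<^bsub>C\<^esub>" 1] M.one_closed a b by simp
    ultimately show False using na by blast
  qed
  have dom: "a \<in> Domain M" if a: "a \<in> carrier G" for a
  proof -
    have "a \<in> Domain M" if "a [^]\<^bsub>G\<^esub> p ^ j \<in> Domain M" for j
      using that
    proof (induction j)
      case 0
      then show ?case using a by simp
    next
      case (Suc j)
      have "a [^]\<^bsub>G\<^esub> p ^ Suc j = (a [^]\<^bsub>G\<^esub> p ^ j) [^]\<^bsub>G\<^esub> p"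
        using a by (simp add: G.int_pow_pow mult.commute)
      then have "a [^]\<^bsub>G\<^esub> p ^ j \<in> Domain M"
        using Suc.prems a by (simp add: dom_p)
      then show ?case by (rule Suc.IH)
    qed
    then show ?thesis using pow[OF a] M(3) by blast
  qed
  define g where "g x = (SOME y. (x, y) \<in> M)" for x
  have g: "(x, g x) \<in> M" if "x \<in> carrier G" for x
    unfolding g_def using dom[OF that] by (meson DomainE someI)
  show ?thesis
  proof (intro bexI ballI)
    show "g \<in> hom G C"
      by (rule homI) (use g M_carr M_fun M_mult G.m_closed in metis)+
    fix u assume u: "u \<in> F0"
    obtain x y where xy: "u = (x, y)" by fastforce
    have "(x, y) \<in> M" using u xy M(3) by blast
    then have "g x = y" using g[OF M_carr(1)] M_fun by blast
    then show "case u of (x, y) \<Rightarrow> g x = y" using xy by simp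
  qed
qed

section \<open>Surjective endomorphisms of bounded primary groups\<close>

context comm_group
begin

lemma subgroup_imp_comm_group:
  assumes "subgroup H G"
  shows "comm_group (G\<lparr>carrier := H\<rparr>)"
  using assms
  by (intro group.group_comm_groupI subgroup_imp_group) (auto simp: subgroup.mem_carrier m_comm)

text \<open>
  The last property says that \<open>p ^ d\<close> times a combination of the \<open>e i\<close> lies in \<open>p ^ (d + 1) G\<close>
  only if \<open>p\<close> divides all coefficients. It is proved by induction on the polynomial:
  applying \<open>\<phi>\<close> removes the lowest coefficient and lowers all indices by one.
\<close>
lemma exists_lift_chain:
  fixes p :: int and k :: nat
  assumes p: "prime p" and \<phi>: "\<phi> \<in> hom G G" and surj: "\<phi> ` carrier G = carrier G"
    and bounded: "\<And>x. x \<in> carrier G \<Longrightarrow> x [^] p ^ k = \<one>"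
    and not_inj: "\<not> inj_on \<phi> (carrier G)"
  obtains d :: nat and e :: "nat \<Rightarrow> 'a" where "range e \<subseteq> carrier G"
    and "\<And>i. e i [^] p ^ Suc d = \<one>" and "\<And>i. \<phi> (e (Suc i)) = e i"
    and "\<And>f y. y \<in> carrier G \<Longrightarrow> lincomb G e f [^] p ^ d = y [^] p ^ Suc d \<Longrightarrow> [:p:] dvd f"
proof -
  have \<phi>_closed: "\<phi> x \<in> carrier G" if "x \<in> carrier G" for x
    using \<phi> that by (auto simp: hom_def)
  have \<phi>_pow: "\<phi> (x [^] n) = \<phi> x [^] n" if "x \<in> carrier G" for x and n :: int
    by (rule hom_int_pow[OF \<phi> that is_group is_group])
  have \<phi>_one: "\<phi> \<one> = \<one>" by (rule hom_one[OF \<phi> is_group is_group])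
  \<comment> \<open>\<open>P m\<close>: the map \<open>\<phi>\<close> is injective on the subgroup of \<open>p ^ m\<close>-th powers.\<close>
  define P where "P m \<longleftrightarrow> (\<forall>x\<in>carrier G. \<phi> (x [^] p ^ m) = \<one> \<longrightarrow> x [^] p ^ m = \<one>)" for m
  have "P k" using bounded by (auto simp: P_def)
  moreover have "\<not> P 0"
    using not_inj inj_on_one_iff'[OF \<phi> is_group is_group] by (auto simp: P_def)
  ultimately obtain d where d: "\<not> P d" "P (Suc d)"
    using ex_least_nat_less[of P k] by auto
  obtain e0 where e0: "e0 \<in> carrier G" "\<phi> (e0 [^] p ^ d) = \<one>" "e0 [^] p ^ d \<noteq> \<one>"
    using d(1) by (auto simp: P_def)
  have P: "x [^] p ^ Suc d = \<one>" if "x \<in> carrier G" "\<phi> (x [^] p ^ Suc d) = \<one>" for x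
    using d(2) that by (auto simp: P_def)
  define e where "e = rec_nat e0 (\<lambda>_ x. SOME y. y \<in> carrier G \<and> \<phi> y = x)"
  have e_0: "e 0 = e0" by (simp add: e_def)
  have "e (Suc i) \<in> carrier G \<and> \<phi> (e (Suc i)) = e i" if "e i \<in> carrier G" for i
  proof -
    have "\<exists>y. y \<in> carrier G \<and> \<phi> y = e i" using that surj by (metis imageE)
    from someI_ex[OF this] show ?thesis by (simp add: e_def)
  qed
  then have e_all: "e i \<in> carrier G \<and> \<phi> (e (Suc i)) = e i" for i
    by (induction i) (use e0(1) e_0 in auto)
  then have e_closed: "e i \<in> carrier G" and e_Suc: "\<phi> (e (Suc i)) = e i" for i by auto
  have range: "range e \<subseteq> carrier G" using e_closed by auto
  have rangeS: "range (\<lambda>i. e (Suc i)) \<subseteq> carrier G" using e_closed by auto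
  have tors: "e i [^] p ^ Suc d = \<one>" for i
  proof (induction i)
    case 0
    have "e0 [^] p ^ Suc d = (e0 [^] p ^ d) [^] p"
      using e0(1) by (simp add: int_pow_pow mult.commute)
    then have "\<phi> (e0 [^] p ^ Suc d) = \<one>" using e0 by (simp add: \<phi>_pow)
    then show ?case using P e0(1) e_0 by simp
  next
    case (Suc i)
    then show ?case using P[OF e_closed] by (simp add: \<phi>_pow e_closed e_Suc)
  qed
  have "[:p:] dvd f" if "y \<in> carrier G" "lincomb G e f [^] p ^ d = y [^] p ^ Suc d" for f y
    using that
  proof (induction f arbitrary: y)
    case (pCons a f)
    let ?L = "lincomb G (\<lambda>i. e (Suc i))"
    note y = pCons.prems(1)
    have L: "lincomb G e (pCons a f) = e0 [^] a \<otimes> ?L f"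
      by (simp add: lincomb_pCons range e_0)
    have ad: "(e0 [^] a) [^] p ^ d = (e0 [^] p ^ d) [^] a"
      using e0(1) by (simp add: int_pow_pow mult.commute)
    \<comment> \<open>The contribution of \<open>e 0\<close> vanishes because its \<open>p ^ d\<close>-th power lies in the kernel.\<close>
    have "\<phi> (lincomb G e (pCons a f) [^] p ^ d) = lincomb G e f [^] p ^ d"
      using e0 rangeS
      by (simp add: L int_pow_distrib ad hom_mult[OF \<phi>] \<phi>_pow hom_lincomb[OF \<phi>] e_Suc \<phi>_closed range)
    then have "lincomb G e f [^] p ^ d = \<phi> y [^] p ^ Suc d"
      using pCons.prems by (simp add: \<phi>_pow)
    from pCons.IH[OF \<phi>_closed[OF y] this] have pf: "[:p:] dvd f" .
    then obtain g where g: "f = smult p g" by (auto elim: dvdE)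
    have "?L f [^] p ^ d = ?L g [^] p ^ Suc d"
      using rangeS by (simp add: g lincomb_smult int_pow_pow)
    then have "(e0 [^] p ^ d) [^] a \<otimes> ?L g [^] p ^ Suc d = y [^] p ^ Suc d"
      using pCons.prems(2) e0(1) rangeS by (simp add: L int_pow_distrib ad)
    then have eq: "(e0 [^] p ^ d) [^] a = (y \<otimes> inv (?L g)) [^] p ^ Suc d"
      using e0(1) rangeS y
      by (simp add: int_pow_distrib int_pow_inv inv_solve_right)
    \<comment> \<open>The left-hand side lies in the kernel, the right-hand side is a \<open>p ^ (d + 1)\<close>-th power, so
      both are trivial.\<close>
    have "\<phi> ((e0 [^] p ^ d) [^] a) = \<one>"
      using e0 by (simp add: \<phi>_pow)
    then have a1: "(e0 [^] p ^ d) [^] a = \<one>"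
      unfolding eq by (rule P[rotated]) (use y rangeS in simp)
    have p1: "(e0 [^] p ^ d) [^] p = \<one>"
      using tors[of 0] e0(1) e_0 by (simp add: int_pow_pow mult.commute)
    have "p dvd a"
    proof (rule ccontr)
      assume "\<not> p dvd a"
      then have "coprime p a" using p prime_imp_coprime by blast
      then obtain u v where uv: "p * u + a * v = 1"
        by (metis bezout_int coprime_imp_gcd_eq_1 mult.commute)
      have "e0 [^] p ^ d = (e0 [^] p ^ d) [^] (p * u + a * v)"
        using e0(1) uv by simp
      also have "\<dots> = ((e0 [^] p ^ d) [^] p) [^] u \<otimes> ((e0 [^] p ^ d) [^] a) [^] v"
        using e0(1) by (simp add: int_pow_mult int_pow_pow mult.assoc)
      also have "\<dots> = \<one>" by (simp add: a1 p1)
      finally show False using e0(3) by blast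
    qed
    then show ?case using pf by (auto simp: const_poly_dvd_iff coeff_pCons split: nat.split)
  qed simp
  then show thesis using range tors e_Suc that by blast
qed

text \<open>
  Independence for \<open>p ^ d\<close>-multiples bootstraps to full independence modulo \<open>p ^ (d + 1) G\<close>:
  one factor \<open>p\<close> of the coefficients is gained at a time.
\<close>
lemma pure_independent:
  fixes p :: int and d :: nat
  assumes range: "range e \<subseteq> carrier G"
    and indep: "\<And>f y. y \<in> carrier G \<Longrightarrow> lincomb G e f [^] p ^ d = y [^] p ^ Suc d \<Longrightarrow> [:p:] dvd f"
    and y: "y \<in> carrier G" and eq: "lincomb G e f = y [^] p ^ Suc d"
  shows "[:p ^ Suc d:] dvd f"
proof -
  have "[:p ^ c:] dvd f" if "c \<le> Suc d" for c
    using that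
  proof (induction c)
    case (Suc c)
    then obtain g where g: "f = smult (p ^ c) g" by (auto elim: dvdE)
    have d: "p ^ c * p ^ (d - c) = p ^ d"
      using Suc.prems by (simp add: power_add[symmetric])
    have "lincomb G e g [^] p ^ d = lincomb G e f [^] p ^ (d - c)"
      using range by (simp add: g lincomb_smult int_pow_pow d)
    also have "\<dots> = (y [^] p ^ (d - c)) [^] p ^ Suc d"
      using y by (simp only: eq int_pow_pow mult.commute)
    finally have "[:p:] dvd g" by (rule indep[rotated]) (use y in simp)
    then show ?case
      by (auto simp: g const_poly_dvd_iff mult.commute[of p] intro!: mult_dvd_mono)
  qed (simp add: pCons_one)
  then show ?thesis by blast
qed

lemma lincomb_torsion:
  assumes "range e \<subseteq> carrier G" and "\<And>i. e i [^] n = \<one>" and "[:n:] dvd f"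
  shows "lincomb G e f = \<one>"
proof -
  obtain g where g: "f = smult n g" using assms(3) by (auto elim: dvdE)
  have "lincomb G e g [^] n = \<one>"
    using assms(1,2)
  proof (induction g arbitrary: e)
    case (pCons a g)
    have "range (\<lambda>i. e (Suc i)) \<subseteq> carrier G" and e0: "e 0 \<in> carrier G" using pCons.prems by auto
    moreover have "(e 0 [^] a) [^] n = \<one>"
      using pCons.prems(2)[of 0] e0 by (metis int_pow_pow int_pow_one mult.commute)
    ultimately show ?case using pCons by (simp add: lincomb_pCons int_pow_distrib)
  qed simp
  then show ?thesis using assms(1) by (simp add: g lincomb_smult)
qed

text \<open>
  For \<open>n = 0\<close> this says that a bounded \<open>p\<close>-group with a surjective, non-injective endomorphism
  is not strongly co-Hopfian. The factor \<open>\<phi> ^^ n\<close> is needed to carry the conclusion over to a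
  larger group whose image under \<open>\<phi> ^^ n\<close> is the given one.
\<close>
lemma exists_endomorphism_unstable_images:
  fixes p :: int and k n :: nat
  assumes p: "prime p" and \<phi>: "\<phi> \<in> hom G G" and surj: "\<phi> ` carrier G = carrier G"
    and bounded: "\<And>x. x \<in> carrier G \<Longrightarrow> x [^] p ^ k = \<one>"
    and not_inj: "\<not> inj_on \<phi> (carrier G)"
  shows "\<exists>g\<in>hom G G. \<forall>N. ((g \<circ> \<phi> ^^ n) ^^ Suc N) ` carrier G \<noteq> ((g \<circ> \<phi> ^^ n) ^^ N) ` carrier G"
proof (rule exists_lift_chain[OF p \<phi> surj bounded not_inj])
  fix d :: nat and e :: "nat \<Rightarrow> 'a"
  assume range: "range e \<subseteq> carrier G" and tors: "\<And>i. e i [^] p ^ Suc d = \<one>"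
    and e_Suc: "\<And>i. \<phi> (e (Suc i)) = e i"
    and indep: "\<And>f y. y \<in> carrier G \<Longrightarrow> lincomb G e f [^] p ^ d = y [^] p ^ Suc d \<Longrightarrow> [:p:] dvd f"
  \<comment> \<open>\<open>S j f\<close> is the combination in which coefficient \<open>i\<close> of \<open>f\<close> belongs to \<open>e (j + i)\<close>.\<close>
  define S where "S j f = lincomb G e (monom 1 j * f)" for j f
  have S_closed: "S j f \<in> carrier G" for j f using range by (simp add: S_def)
  have S_add: "S j (f + g) = S j f \<otimes> S j g" for j f g
    using range by (simp add: S_def distrib_left lincomb_add)
  have S_uminus: "S j (- f) = inv S j f" for j f
    using range by (simp add: S_def lincomb_uminus)
  have S_smult: "S j (smult c f) = S j f [^] c" for j c f
    using range by (simp add: S_def lincomb_smult)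
  have S_tors: "S j f = \<one>" if "[:p ^ Suc d:] dvd f" for j f
    unfolding S_def by (rule lincomb_torsion[OF range tors]) (use that in simp)
  have monom_dvd: "[:c:] dvd f" if "[:c:] dvd monom 1 j * f" for c :: int and j f
    unfolding const_poly_dvd_iff
  proof
    fix i
    have "c dvd coeff (monom 1 j * f) (j + i)"
      using that unfolding const_poly_dvd_iff by blast
    then show "c dvd coeff f i" by (simp add: coeff_monom_mult)
  qed
  have S_\<phi>: "(\<phi> ^^ j) (S j f) = S 0 f" for j f
  proof (induction j)
    case (Suc j)
    have "\<phi> (S (Suc j) f) = \<phi> (lincomb G e (pCons 0 (monom 1 j * f)))"
      by (simp add: S_def monom_Suc)
    also have "\<dots> = S j f"
      using range
      by (simp add: lincomb_pCons hom_lincomb[OF \<phi>] e_Suc image_subset_iff S_def)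
    finally show ?case using Suc by (simp add: funpow_Suc_right del: funpow.simps)
  qed simp

  define B where "B = range (S (Suc n))"
  have S_B: "S (Suc n) f \<in> B" for f by (simp add: B_def)
  have B_sub: "subgroup B G"
  proof (rule subgroupI)
    show "B \<subseteq> carrier G" "B \<noteq> {}" using S_closed by (auto simp: B_def)
    show "inv a \<in> B" if "a \<in> B" for a
      using that S_uminus[symmetric] by (auto simp: B_def)
    show "a \<otimes> b \<in> B" if "a \<in> B" "b \<in> B" for a b
      using that S_add[symmetric] by (auto simp: B_def)
  qed
  let ?C = "G\<lparr>carrier := B\<rparr>"
  have C: "comm_group ?C" by (rule subgroup_imp_comm_group[OF B_sub])
  interpret C: comm_group ?C by fact
  have C_pow: "b [^]\<^bsub>?C\<^esub> m = b [^] m" if "b \<in> B" for b and m :: int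
    using int_pow_consistent[OF B_sub that] by simp

  \<comment> \<open>The graph of the map that kills all \<open>p ^ (d + 1)\<close>-th powers and sends \<open>e i\<close> to \<open>e (Suc n + i)\<close>.\<close>
  define F0 where "F0 = {(y [^] p ^ Suc d \<otimes> S 0 f, S (Suc n) f) | y f. y \<in> carrier G}"
  have F0_I: "(y [^] p ^ Suc d \<otimes> S 0 f, S (Suc n) f) \<in> F0" if "y \<in> carrier G" for y f
    using that by (auto simp: F0_def)
  have "F0 \<in> partial_homs G ?C"
  proof -
    interpret P: group "G \<times>\<times> ?C" by (rule DirProd_group) unfold_locales
    have "subgroup F0 (G \<times>\<times> ?C)"
    proof (rule P.subgroupI)
      show "F0 \<subseteq> carrier (G \<times>\<times> ?C)" using S_closed by (auto simp: F0_def B_def)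
      show "F0 \<noteq> {}" using F0_I[OF one_closed] by blast
      fix u assume "u \<in> F0"
      then obtain y f where u: "u = (y [^] p ^ Suc d \<otimes> S 0 f, S (Suc n) f)" and y: "y \<in> carrier G"
        unfolding F0_def by blast
      have "inv\<^bsub>G \<times>\<times> ?C\<^esub> u = ((inv y) [^] p ^ Suc d \<otimes> S 0 (- f), S (Suc n) (- f))"
        unfolding u using y S_closed
        by (subst inv_DirProd)
          (simp_all add: S_B C.is_group m_inv_consistent[OF B_sub] S_uminus inv_mult int_pow_inv
            del: power_Suc)
      then show "inv\<^bsub>G \<times>\<times> ?C\<^esub> u \<in> F0" using F0_I[of "inv y" "- f"] y by simp
      fix v assume "v \<in> F0"
      then obtain z g where v: "v = (z [^] p ^ Suc d \<otimes> S 0 g, S (Suc n) g)" and z: "z \<in> carrier G"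
        unfolding F0_def by blast
      have "u \<otimes>\<^bsub>G \<times>\<times> ?C\<^esub> v = ((y \<otimes> z) [^] p ^ Suc d \<otimes> S 0 (f + g), S (Suc n) (f + g))"
        unfolding u v using y z S_closed
        by (simp add: S_add int_pow_distrib m_ac del: power_Suc)
      then show "u \<otimes>\<^bsub>G \<times>\<times> ?C\<^esub> v \<in> F0" using F0_I[of "y \<otimes> z" "f + g"] y z by simp
    qed
    moreover have "c = \<one>" if oc: "(\<one>, c) \<in> F0" for c
    proof -
      obtain y f where eq: "\<one> = y [^] p ^ Suc d \<otimes> S 0 f" and y: "y \<in> carrier G" and c: "c = S (Suc n) f"
        using oc unfolding F0_def by blast
      have "S 0 f = inv (y [^] p ^ Suc d)"
        using eq y S_closed by (metis int_pow_closed inv_equality m_comm)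
      then have "lincomb G e f = (inv y) [^] p ^ Suc d"
        using y by (simp add: S_def monom_0 int_pow_inv)
      then have "[:p ^ Suc d:] dvd f"
        using y by (intro pure_independent[OF range indep]) auto
      then show ?thesis using c S_tors by simp
    qed
    ultimately show ?thesis by (simp add: partial_homs_def)
  qed
  moreover have "(y [^] p ^ Suc d, \<one>\<^bsub>?C\<^esub>) \<in> F0" if "y \<in> carrier G" for y
    using F0_I[OF that, of 0] that range by (simp add: S_def del: power_Suc)
  moreover have "\<exists>b\<in>carrier ?C. c = b [^]\<^bsub>?C\<^esub> p"
    if c: "c \<in> carrier ?C" and c1: "c [^]\<^bsub>?C\<^esub> p ^ d = \<one>\<^bsub>?C\<^esub>" for c
  proof -
    obtain f where f: "c = S (Suc n) f" using c by (auto simp: B_def)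
    have "c [^] p ^ d = \<one>" using c c1 by (simp add: C_pow)
    then have "lincomb G e (monom 1 (Suc n) * f) [^] p ^ d = \<one> [^] p ^ Suc d"
      by (simp add: f S_def)
    then have "[:p:] dvd monom 1 (Suc n) * f" by (rule indep[OF one_closed])
    then have "[:p:] dvd f" by (rule monom_dvd)
    then obtain h where "f = smult p h" by (auto elim: dvdE)
    then have "c = S (Suc n) h [^] p" by (simp add: f S_smult)
    then show ?thesis using C_pow by (intro bexI[of _ "S (Suc n) h"]) (auto simp: B_def)
  qed
  ultimately obtain g where g: "g \<in> hom G ?C" "\<forall>(x, y)\<in>F0. g x = y"
    using extend_partial_hom[OF comm_group_axioms C p] by blast
  have g_B: "g x \<in> B" if "x \<in> carrier G" for x
    using g(1) that by (auto simp: hom_def)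
  have g_hom: "g \<in> hom G G"
    using g(1) subgroup.subset[OF B_sub] by (auto simp: hom_def)
  have g_S: "g (S 0 f) = S (Suc n) f" for f
    using bspec[OF g(2) F0_I[OF one_closed, of f]] S_closed by simp
  let ?\<psi> = "g \<circ> \<phi> ^^ n"
  have step: "?\<psi> (S (n + j) f) = S (n + Suc j) f" for j f
  proof -
    have "(\<phi> ^^ n) (S (n + j) f) = S 0 (monom 1 j * f)"
      using S_\<phi>[of n "monom 1 j * f"] by (simp add: S_def mult.assoc[symmetric] mult_monom)
    then show ?thesis
      by (simp add: g_S) (simp add: S_def mult.assoc[symmetric] mult_monom)
  qed
  have iter: "(?\<psi> ^^ j) (S n f) = S (n + j) f" for j f
    by (induction j) (use step in auto)
  have \<phi>n: "(\<phi> ^^ n) x \<in> carrier G" if "x \<in> carrier G" for x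
    by (induction n) (use \<phi> that in \<open>auto simp: hom_def\<close>)
  have image: "(?\<psi> ^^ Suc j) x \<in> range (S (n + Suc j))" if x: "x \<in> carrier G" for j x
  proof (induction j)
    case 0
    then show ?case using g_B[OF \<phi>n[OF x]] by (simp add: B_def)
  next
    case (Suc j)
    then obtain f where "(?\<psi> ^^ Suc j) x = S (n + Suc j) f" by blast
    then have "(?\<psi> ^^ Suc (Suc j)) x = S (n + Suc (Suc j)) f"
      using step[of "Suc j" f] by (simp only: funpow.simps o_apply)
    then show ?case by blast
  qed
  show ?thesis
  proof (intro bexI[OF _ g_hom] allI notI)
    fix N assume eq: "(?\<psi> ^^ Suc N) ` carrier G = (?\<psi> ^^ N) ` carrier G"
    \<comment> \<open>The images are separated by \<open>e (n + N)\<close>, which is \<open>S (n + N) 1\<close>.\<close>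
    have "S (n + N) 1 \<in> (?\<psi> ^^ N) ` carrier G"
      using iter[of N 1] S_closed by (metis imageI)
    then have "S (n + N) 1 \<in> (?\<psi> ^^ Suc N) ` carrier G" by (simp only: eq)
    then obtain x where x: "x \<in> carrier G" "S (n + N) 1 = (?\<psi> ^^ Suc N) x" by (rule imageE)
    obtain f where f: "S (n + N) 1 = S (n + Suc N) f"
      using image[OF x(1), of N] unfolding x(2)[symmetric] by (rule rangeE)
    let ?q = "monom 1 (n + N) - monom 1 (n + Suc N) * f :: int poly"
    have "lincomb G e ?q = S (n + N) 1 \<otimes> inv S (n + Suc N) f"
      using range S_uminus[of "n + Suc N" f]
      by (simp add: S_def lincomb_add diff_conv_add_uminus del: add_uminus_conv_diff)
    then have "lincomb G e ?q [^] p ^ d = \<one> [^] p ^ Suc d"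
      using f S_closed by simp
    then have "[:p:] dvd ?q" by (rule indep[OF one_closed])
    then have "p dvd coeff ?q (n + N)" unfolding const_poly_dvd_iff by blast
    then show False using p by (simp add: coeff_monom_mult not_prime_unit)
  qed
qed

end

section \<open>Splitting off the torsion at a prime\<close>

context comm_group
begin

lemma int_pow_hom: "(\<lambda>x. x [^] (n::int)) \<in> hom G G"
  by (rule homI) (auto simp: int_pow_distrib)

lemma funpow_hom: "\<phi> \<in> hom G G \<Longrightarrow> \<phi> ^^ n \<in> hom G G"
proof (induction n)
  case (Suc n)
  then show ?case using Group.hom_compose[of "\<phi> ^^ n" G G \<phi> G] by (simp only: funpow.simps)
qed (simp add: hom_def)

text \<open>
  It suffices to extract roots of prime order.
\<close>
lemma divisible_subgroupI:
  assumes D: "subgroup D G"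
    and root: "\<And>(p::int) x. prime p \<Longrightarrow> x \<in> D \<Longrightarrow> \<exists>y\<in>D. y [^] p = x"
  shows "divisible_subgroup D G"
proof -
  have "\<forall>x\<in>D. \<exists>y\<in>D. y [^] int n = x" if "n > 0" for n
    using that
  proof (induction n rule: prime_divisors_induct)
    case (unit n)
    then show ?case using subgroup.mem_carrier[OF D] by auto
  next
    case (factor p n)
    show ?case
    proof
      fix x assume "x \<in> D"
      then obtain y where y: "y \<in> D" "y [^] int n = x" using factor by auto
      obtain z where z: "z \<in> D" "z [^] int p = y"
        using root[OF _ y(1), of "int p"] factor.hyps by auto
      have "z [^] int (p * n) = x"
        using y z subgroup.mem_carrier[OF D z(1)] by (auto simp: int_pow_pow)
      then show "\<exists>y\<in>D. y [^] int (p * n) = x" using z(1) by blast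
    qed
  qed simp
  then show ?thesis
    using D by (simp add: divisible_subgroup_def int_pow_int)
qed

text \<open>
  The subgroups of \<open>p ^ i\<close>-th powers are the images of the iterates of \<open>x \<mapsto> x [^] p\<close>.
\<close>
lemma strongly_co_Hopfian_powers_stabilize:
  fixes p :: int
  assumes "strongly_co_Hopfian G"
  obtains k :: nat where
    "\<And>x j. x \<in> carrier G \<Longrightarrow> \<exists>y\<in>carrier G. x [^] p ^ k = y [^] p ^ (k + j)"
proof -
  let ?f = "\<lambda>x. x [^] p"
  obtain k where k: "ScoH_exponent G ?f k"
    using assms int_pow_hom by (auto simp: strongly_co_Hopfian_def)
  have f: "(?f ^^ m) x = x [^] p ^ m" if "x \<in> carrier G" for m x
    by (induction m) (use that in \<open>auto simp: int_pow_pow mult.commute\<close>)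
  show thesis
  proof (rule that)
    fix x j assume x: "x \<in> carrier G"
    have "(?f ^^ k) x \<in> (?f ^^ (k + j)) ` carrier G"
      using k x unfolding ScoH_exponent_def by (metis imageI le_add1)
    then show "\<exists>y\<in>carrier G. x [^] p ^ k = y [^] p ^ (k + j)"
      using f x by auto
  qed
qed

text \<open>
  The \<open>p\<close>-torsion of the stable subgroup of \<open>p ^ k\<close>-th powers is divisible: by \<open>p\<close> because of
  stability, and by any other prime because it is \<open>p\<close>-torsion.
\<close>
lemma reduced_no_torsion_in_stable_power:
  fixes p :: int and k :: nat
  assumes red: "reduced_group G" and p: "prime p"
    and stab: "\<And>x j. x \<in> carrier G \<Longrightarrow> \<exists>y\<in>carrier G. x [^] p ^ k = y [^] p ^ (k + j)"
    and z: "z \<in> carrier G" "(z [^] p ^ k) [^] p ^ j = \<one>"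
  shows "z [^] p ^ k = \<one>"
proof -
  define D where "D = {x [^] p ^ k | x. x \<in> carrier G \<and> (\<exists>i. (x [^] p ^ k) [^] p ^ (i::nat) = \<one>)}"
  have D_I: "x [^] p ^ k \<in> D" if "x \<in> carrier G" "(x [^] p ^ k) [^] p ^ i = \<one>" for x and i :: nat
    using that by (auto simp: D_def)
  have D_sub: "subgroup D G"
  proof (rule subgroupI)
    show "D \<subseteq> carrier G" by (auto simp: D_def)
    show "D \<noteq> {}" using D_I[OF one_closed, of 0] by auto
    fix a assume "a \<in> D"
    then obtain x i where x: "a = x [^] p ^ k" "x \<in> carrier G" "(x [^] p ^ k) [^] p ^ i = \<one>"
      unfolding D_def by blast
    have "(inv x) [^] p ^ k \<in> D"
      using x by (intro D_I[of _ i]) (auto simp: int_pow_inv)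
    then show "inv a \<in> D" using x by (simp add: int_pow_inv)
    fix b assume "b \<in> D"
    then obtain y j where y: "b = y [^] p ^ k" "y \<in> carrier G" "(y [^] p ^ k) [^] p ^ j = \<one>"
      unfolding D_def by blast
    have "(x [^] p ^ k) [^] p ^ (i + j) = ((x [^] p ^ k) [^] p ^ i) [^] p ^ j"
      using x(2) by (simp add: int_pow_pow power_add mult.assoc)
    moreover have "(y [^] p ^ k) [^] p ^ (i + j) = ((y [^] p ^ k) [^] p ^ j) [^] p ^ i"
      using y(2) by (simp add: int_pow_pow power_add mult_ac)
    ultimately have "(x \<otimes> y) [^] p ^ k \<in> D"
      using x y by (intro D_I[of _ "i + j"]) (simp_all add: int_pow_distrib)
    then show "a \<otimes> b \<in> D" using x y by (simp add: int_pow_distrib)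
  qed
  have "divisible_subgroup D G"
  proof (rule divisible_subgroupI[OF D_sub])
    fix q :: int and a assume q: "prime q" and "a \<in> D"
    then obtain x i where x: "a = x [^] p ^ k" "x \<in> carrier G" "(x [^] p ^ k) [^] p ^ i = \<one>"
      unfolding D_def by blast
    show "\<exists>b\<in>D. b [^] q = a"
    proof (cases "q = p")
      case True
      obtain y where y: "y \<in> carrier G" "x [^] p ^ k = y [^] p ^ (k + 1)" using stab[OF x(2)] by blast
      have yp: "(y [^] p ^ k) [^] p = a"
        using y x by (simp add: int_pow_pow mult.commute)
      have "(y [^] p ^ k) [^] p ^ Suc i = ((y [^] p ^ k) [^] p) [^] p ^ i"
        using y by (simp add: int_pow_pow mult.assoc)
      also have "\<dots> = \<one>" using x(1,3) yp by simp
      finally have "y [^] p ^ k \<in> D" by (rule D_I[OF y(1)])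
      then show ?thesis using yp True by blast
    next
      case False
      have "coprime q (p ^ i)" using primes_coprime[OF q p] False by simp
      then obtain u v where uv: "u * q + v * p ^ i = 1"
        by (metis bezout_int coprime_imp_gcd_eq_1)
      have a: "a \<in> carrier G" using x by simp
      have "a = a [^] (u * q + v * p ^ i)" using a uv by simp
      also have "\<dots> = (a [^] u) [^] q \<otimes> (a [^] p ^ i) [^] v"
        using a by (simp add: int_pow_mult int_pow_pow mult.commute)
      also have "\<dots> = (a [^] u) [^] q" using x a by simp
      finally have root: "(a [^] u) [^] q = a" by (rule sym)
      have "a [^] u \<in> D"
        using subgroup_int_pow_closed[OF D_sub \<open>a \<in> D\<close>] .
      then show ?thesis using root by (rule bexI[rotated])
    qed
  qed
  then have "D = {\<one>}" using red by (simp add: reduced_group_def)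
  then show ?thesis using D_I[OF z] by simp
qed

text \<open>
  If \<open>x \<mapsto> x [^] q\<close> is bijective on the subgroup \<open>Q\<close> of all \<open>q\<close>-th powers, then \<open>G\<close> is the direct
  sum of its \<open>q\<close>-torsion and \<open>Q\<close>. Both summands are fully invariant, so the projection \<open>\<pi>\<close> to the
  torsion commutes with every endomorphism.
\<close>
lemma exists_torsion_projection:
  fixes q :: int
  assumes div: "\<And>x. x \<in> carrier G \<Longrightarrow> \<exists>y\<in>carrier G. x [^] q = (y [^] q) [^] q"
    and tf: "\<And>x. x \<in> carrier G \<Longrightarrow> (x [^] q) [^] q = \<one> \<Longrightarrow> x [^] q = \<one>"
  obtains \<pi> where "\<pi> \<in> hom G G"
    and "\<And>x. x \<in> carrier G \<Longrightarrow> \<pi> x [^] q = \<one>"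
    and "\<And>x. x \<in> carrier G \<Longrightarrow> x [^] q = \<one> \<Longrightarrow> \<pi> x = x"
    and "\<And>x. x \<in> carrier G \<Longrightarrow> \<pi> x = \<one> \<Longrightarrow> \<exists>y\<in>carrier G. x = y [^] q"
    and "\<And>\<phi> x. \<phi> \<in> hom G G \<Longrightarrow> x \<in> carrier G \<Longrightarrow> \<pi> (\<phi> x) = \<phi> (\<pi> x)"
proof -
  define Q where "Q = (\<lambda>x. x [^] q) ` carrier G"
  \<comment> \<open>The projection to \<open>Q\<close>.\<close>
  define r where "r g = (SOME z. z \<in> Q \<and> z [^] q = g [^] q)" for g
  have Q_carr: "z \<in> carrier G" if "z \<in> Q" for z using that by (auto simp: Q_def)
  have Q_mult: "z \<otimes> w \<in> Q" if "z \<in> Q" "w \<in> Q" for z w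
    using that by (auto simp: Q_def int_pow_distrib[symmetric])
  have Q_inv: "inv z \<in> Q" if "z \<in> Q" for z
    using that by (auto simp: Q_def int_pow_inv[symmetric])
  have Q_tf: "z = \<one>" if "z \<in> Q" "z [^] q = \<one>" for z
    using that tf by (auto simp: Q_def)
  have r: "r g \<in> Q" "r g [^] q = g [^] q" if "g \<in> carrier G" for g
  proof -
    have "\<exists>z. z \<in> Q \<and> z [^] q = g [^] q" using div[OF that] by (auto simp: Q_def)
    from someI_ex[OF this] show "r g \<in> Q" "r g [^] q = g [^] q" by (auto simp: r_def)
  qed
  have r_eq: "r g = z" if "g \<in> carrier G" "z \<in> Q" "z [^] q = g [^] q" for g z
  proof -
    have "(r g \<otimes> inv z) [^] q = \<one>"
      using r[OF that(1)] that Q_carr by (simp add: int_pow_distrib int_pow_inv)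
    then have "r g \<otimes> inv z = \<one>" using Q_tf Q_mult Q_inv r that by blast
    then show ?thesis using r Q_carr that by (metis inv_closed inv_equality inv_inv)
  qed
  have r_carr: "r g \<in> carrier G" if "g \<in> carrier G" for g using r Q_carr that by blast
  have r_mult: "r (g \<otimes> h) = r g \<otimes> r h" if "g \<in> carrier G" "h \<in> carrier G" for g h
    by (rule r_eq) (use r r_carr that Q_mult in \<open>auto simp: int_pow_distrib\<close>)
  have r_hom: "r (\<phi> g) = \<phi> (r g)" if \<phi>: "\<phi> \<in> hom G G" and g: "g \<in> carrier G" for \<phi> g
  proof (rule r_eq)
    have pow: "\<phi> (x [^] q) = \<phi> x [^] q" if "x \<in> carrier G" for x
      by (rule hom_int_pow[OF \<phi> that is_group is_group])
    show "\<phi> g \<in> carrier G" using \<phi> g by (auto simp: hom_def)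
    obtain x where x: "x \<in> carrier G" "r g = x [^] q" using r(1)[OF g] by (auto simp: Q_def)
    have "\<phi> x \<in> carrier G" using \<phi> x by (auto simp: hom_def)
    then show "\<phi> (r g) \<in> Q" using x pow by (auto simp: Q_def)
    show "\<phi> (r g) [^] q = \<phi> g [^] q"
      using r[OF g] r_carr[OF g] g by (simp add: pow[symmetric])
  qed
  define \<pi> where "\<pi> g = g \<otimes> inv (r g)" for g
  show thesis
  proof (rule that[of \<pi>])
    show "\<pi> \<in> hom G G"
      by (rule homI) (use r_carr in \<open>auto simp: \<pi>_def r_mult inv_mult m_ac\<close>)
    show "\<pi> x [^] q = \<one>" if "x \<in> carrier G" for x
      using that r r_carr by (simp add: \<pi>_def int_pow_distrib int_pow_inv)
    show "\<pi> x = x" if "x \<in> carrier G" "x [^] q = \<one>" for x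
    proof -
      have "\<one> \<in> Q" unfolding Q_def by (rule image_eqI[of _ _ \<one>]) auto
      then have "r x = \<one>" using that by (intro r_eq) auto
      then show ?thesis using that by (simp add: \<pi>_def)
    qed
    show "\<exists>y\<in>carrier G. x = y [^] q" if "x \<in> carrier G" "\<pi> x = \<one>" for x
    proof -
      have "x = r x" using that r_carr by (metis \<pi>_def inv_closed inv_equality inv_inv)
      then show ?thesis using r(1)[OF that(1)] by (auto simp: Q_def)
    qed
    show "\<pi> (\<phi> x) = \<phi> (\<pi> x)" if \<phi>: "\<phi> \<in> hom G G" and "x \<in> carrier G" for \<phi> x
    proof -
      interpret \<phi>: group_hom G G \<phi> by unfold_locales (rule \<phi>)
      show ?thesis using that r_carr by (simp add: \<pi>_def r_hom)
    qed
  qed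
qed

text \<open>
  Here \<open>\<pi>\<close> is the projection to the \<open>p ^ k\<close>-torsion. An endomorphism of \<open>H = \<pi> (\<phi> ^^ n G)\<close> with
  unstable images is turned into one of \<open>G\<close> by means of the surjection \<open>\<phi> ^^ n \<circ> \<pi>\<close> from \<open>G\<close> to \<open>H\<close>.
\<close>
lemma stable_image_torsion_injective:
  fixes p :: int and k n :: nat
  assumes scoh: "strongly_co_Hopfian G" and p: "prime p"
    and \<pi>: "\<pi> \<in> hom G G"
    and \<pi>_tors: "\<And>x. x \<in> carrier G \<Longrightarrow> \<pi> x [^] p ^ k = \<one>"
    and \<pi>_id: "\<And>x. x \<in> carrier G \<Longrightarrow> x [^] p ^ k = \<one> \<Longrightarrow> \<pi> x = x"
    and \<phi>: "\<phi> \<in> hom G G" and comm: "\<And>x. x \<in> carrier G \<Longrightarrow> \<pi> (\<phi> x) = \<phi> (\<pi> x)"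
    and n: "ScoH_exponent G \<phi> n"
  shows "inj_on \<phi> (\<pi> ` (\<phi> ^^ n) ` carrier G)"
proof -
  define H where "H = \<pi> ` (\<phi> ^^ n) ` carrier G"
  have \<phi>_closed: "\<phi> x \<in> carrier G" and \<pi>_closed: "\<pi> x \<in> carrier G" if "x \<in> carrier G" for x
    using \<phi> \<pi> that by (auto simp: hom_def)
  have \<phi>n: "(\<phi> ^^ m) x \<in> carrier G" if "x \<in> carrier G" for m x
    using funpow_hom[OF \<phi>, of m] that by (auto simp: hom_def)
  have commn: "\<pi> ((\<phi> ^^ m) x) = (\<phi> ^^ m) (\<pi> x)" if "x \<in> carrier G" for m x
    by (induction m) (use that in \<open>auto simp: comm \<phi>n\<close>)
  have H_carr: "H \<subseteq> carrier G" using \<phi>n \<pi>_closed by (auto simp: H_def)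
  have H_eq: "H = (\<phi> ^^ n) ` \<pi> ` carrier G"
    using commn by (force simp: H_def image_image)
  have H_sub: "subgroup H G"
  proof -
    interpret h: group_hom G G "\<pi> \<circ> \<phi> ^^ n"
      by unfold_locales (rule Group.hom_compose[OF funpow_hom[OF \<phi>] \<pi>])
    show ?thesis using h.img_is_subgroup by (simp add: H_def image_comp)
  qed
  have \<pi>H: "\<pi> x = x" if "x \<in> H" for x
    using that \<pi>_id \<pi>_tors \<pi>_closed \<phi>n by (auto simp: H_def)
  have img: "(\<phi> ^^ n) ` carrier G = (\<phi> ^^ Suc n) ` carrier G"
    using n unfolding ScoH_exponent_def by (meson le_Suc_eq order_refl)
  have "\<phi> ` H = \<pi> ` \<phi> ` (\<phi> ^^ n) ` carrier G"
    using comm \<phi>n by (force simp: H_def image_image)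
  also have "\<dots> = \<pi> ` (\<phi> ^^ Suc n) ` carrier G" by (simp add: image_comp comp_assoc)
  finally have surj: "\<phi> ` H = H" unfolding H_def img[symmetric] .
  have surjn: "(\<phi> ^^ m) ` H = H" for m
    by (induction m) (simp_all only: funpow.simps image_comp[symmetric] surj image_id id_def image_ident)
  let ?H = "G\<lparr>carrier := H\<rparr>"
  interpret H: comm_group ?H by (rule subgroup_imp_comm_group[OF H_sub])
  have \<phi>_H: "\<phi> \<in> hom ?H ?H"
  proof (rule homI)
    show "\<phi> x \<in> carrier ?H" if "x \<in> carrier ?H" for x
      using that surj by auto
    show "\<phi> (x \<otimes>\<^bsub>?H\<^esub> y) = \<phi> x \<otimes>\<^bsub>?H\<^esub> \<phi> y" if "x \<in> carrier ?H" "y \<in> carrier ?H" for x y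
      using that H_carr by (simp add: hom_mult[OF \<phi>] subset_iff)
  qed
  show ?thesis
  proof (rule ccontr)
    assume "\<not> ?thesis"
    then have "\<not> inj_on \<phi> (carrier ?H)" by (simp add: H_def)
    moreover have "x [^]\<^bsub>?H\<^esub> p ^ k = \<one>\<^bsub>?H\<^esub>" if "x \<in> carrier ?H" for x
      using that \<pi>_tors \<phi>n int_pow_consistent[OF H_sub, of x "p ^ k", symmetric]
      by (auto simp: H_def)
    moreover have "\<phi> ` carrier ?H = carrier ?H" using surj by simp
    ultimately obtain g where g: "g \<in> hom ?H ?H"
      and unstable: "\<And>N. ((g \<circ> \<phi> ^^ n) ^^ Suc N) ` H \<noteq> ((g \<circ> \<phi> ^^ n) ^^ N) ` H"
      using H.exists_endomorphism_unstable_images[OF p \<phi>_H, of k n] by auto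
    let ?\<psi> = "g \<circ> \<phi> ^^ n"
    let ?\<Psi> = "g \<circ> (\<phi> ^^ n \<circ> \<pi>)"
    have \<psi>_H: "?\<psi> x \<in> H" if "x \<in> H" for x
    proof -
      have "(\<phi> ^^ n) x \<in> H" using surjn that by blast
      then show ?thesis using g by (auto simp: hom_def)
    qed
    have \<psi>n_H: "(?\<psi> ^^ m) x \<in> H" if "x \<in> H" for m x
      by (induction m) (use that \<psi>_H in auto)
    have "\<phi> ^^ n \<circ> \<pi> \<in> hom G ?H"
    proof -
      have "\<phi> ^^ n \<circ> \<pi> \<in> hom G G" by (rule Group.hom_compose[OF \<pi> funpow_hom[OF \<phi>]])
      then show ?thesis using H_eq by (auto simp: hom_def)
    qed
    then have "?\<Psi> \<in> hom G ?H" using g by (rule Group.hom_compose)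
    then have \<Psi>: "?\<Psi> \<in> hom G G" using H_carr by (auto simp: hom_def)
    \<comment> \<open>\<open>?\<Psi>\<close> extends \<open>?\<psi>\<close>, and both have image \<open>g ` H\<close>.\<close>
    have eq: "(?\<Psi> ^^ Suc j) ` carrier G = (?\<psi> ^^ Suc j) ` H" for j
    proof (induction j)
      case 0
      have "?\<Psi> ` carrier G = g ` H" by (simp add: H_eq image_comp comp_assoc)
      also have "\<dots> = g ` (\<phi> ^^ n) ` H" by (simp only: surjn)
      finally show ?case by (simp add: image_comp)
    next
      case (Suc j)
      have "(?\<Psi> ^^ Suc (Suc j)) ` carrier G = ?\<Psi> ` (?\<Psi> ^^ Suc j) ` carrier G"
        by (simp only: funpow.simps(2)[of "Suc j"] image_comp)
      also have "\<dots> = ?\<Psi> ` (?\<psi> ^^ Suc j) ` H" by (simp only: Suc.IH)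
      also have "\<dots> = ?\<psi> ` (?\<psi> ^^ Suc j) ` H"
      proof (rule image_cong[OF refl])
        fix y assume "y \<in> (?\<psi> ^^ Suc j) ` H"
        then have "y \<in> H" using \<psi>n_H by blast
        then show "?\<Psi> y = ?\<psi> y" by (simp add: \<pi>H)
      qed
      also have "\<dots> = (?\<psi> ^^ Suc (Suc j)) ` H"
        by (simp only: funpow.simps(2)[of "Suc j"] image_comp)
      finally show ?case .
    qed
    obtain N where "ScoH_exponent G ?\<Psi> N"
      using scoh \<Psi> by (auto simp: strongly_co_Hopfian_def)
    then have N: "N > 0" "\<And>m. m \<ge> N \<Longrightarrow> (?\<Psi> ^^ N) ` carrier G = (?\<Psi> ^^ m) ` carrier G"
      by (auto simp: ScoH_exponent_def)
    have "(?\<Psi> ^^ Suc (N - 1)) ` carrier G = (?\<Psi> ^^ Suc N) ` carrier G"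
      using N(2)[of "Suc N"] N(1) by simp
    then have "(?\<psi> ^^ Suc (N - 1)) ` H = (?\<psi> ^^ Suc N) ` H"
      unfolding eq .
    then show False using unstable[of N] N(1) by simp
  qed
qed

text \<open>
  The elements that are \<open>p ^ j\<close>-th powers for all primes \<open>p\<close> and all \<open>j\<close> form a divisible subgroup.
  To divide \<open>a = b [^] p ^ (k + 1)\<close> by \<open>p\<close>, take \<open>c = b [^] p ^ k\<close> with \<open>k\<close> in the stable range: it is
  a \<open>p ^ j\<close>-th power by stability, and a \<open>q ^ j\<close>-th power for a prime \<open>q \<noteq> p\<close> because \<open>c [^] p = a\<close> is one.
\<close>
lemma reduced_common_prime_powers_trivial:
  assumes red: "reduced_group G" and scoh: "strongly_co_Hopfian G"
    and x: "x \<in> carrier G"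
    and pow: "\<And>(p::int) (j::nat). prime p \<Longrightarrow> \<exists>y\<in>carrier G. x = y [^] p ^ j"
  shows "x = \<one>"
proof -
  define D where "D = {x \<in> carrier G. \<forall>p j. prime (p::int) \<longrightarrow> (\<exists>y\<in>carrier G. x = y [^] p ^ (j::nat))}"
  have D_sub: "subgroup D G"
  proof (rule subgroupI)
    show "D \<subseteq> carrier G" by (auto simp: D_def)
    have "\<one> \<in> D" unfolding D_def by (auto intro!: bexI[of _ \<one>])
    then show "D \<noteq> {}" by blast
    fix a assume a: "a \<in> D"
    show "inv a \<in> D"
      unfolding D_def
    proof (intro CollectI conjI allI impI)
      show "inv a \<in> carrier G" using a by (auto simp: D_def)
      fix p :: int and j :: nat assume "prime p"
      then obtain y where "y \<in> carrier G" "a = y [^] p ^ j" using a unfolding D_def by blast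
      then show "\<exists>y\<in>carrier G. inv a = y [^] p ^ j"
        by (intro bexI[of _ "inv y"]) (auto simp: int_pow_inv)
    qed
    fix b assume b: "b \<in> D"
    show "a \<otimes> b \<in> D"
      unfolding D_def
    proof (intro CollectI conjI allI impI)
      show "a \<otimes> b \<in> carrier G" using a b by (auto simp: D_def)
      fix p :: int and j :: nat assume p: "prime p"
      obtain y where "y \<in> carrier G" "a = y [^] p ^ j" using a p unfolding D_def by blast
      moreover obtain z where "z \<in> carrier G" "b = z [^] p ^ j" using b p unfolding D_def by blast
      ultimately show "\<exists>y\<in>carrier G. a \<otimes> b = y [^] p ^ j"
        by (intro bexI[of _ "y \<otimes> z"]) (auto simp: int_pow_distrib)
    qed
  qed
  have "divisible_subgroup D G"
  proof (rule divisible_subgroupI[OF D_sub])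
    fix p :: int and a assume p: "prime p" and a: "a \<in> D"
    obtain k where k: "\<And>x j. x \<in> carrier G \<Longrightarrow> \<exists>y\<in>carrier G. x [^] p ^ k = y [^] p ^ (k + j)"
      using strongly_co_Hopfian_powers_stabilize[OF scoh, of p] by blast
    obtain b where b: "b \<in> carrier G" "a = b [^] p ^ (k + 1)"
      using a p unfolding D_def by blast
    define c where "c = b [^] p ^ k"
    have c: "c \<in> carrier G" "c [^] p = a" using b by (auto simp: c_def int_pow_pow mult.commute)
    have "c \<in> D"
      unfolding D_def
    proof (intro CollectI conjI allI impI)
      show "c \<in> carrier G" by fact
      fix q :: int and j :: nat assume q: "prime q"
      show "\<exists>y\<in>carrier G. c = y [^] q ^ j"
      proof (cases "q = p")
        case True
        obtain y where y: "y \<in> carrier G" "c = y [^] p ^ (k + j)" using k[OF b(1)] c_def by blast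
        then have "c = (y [^] p ^ k) [^] q ^ j" by (simp add: True int_pow_pow power_add)
        then show ?thesis using y(1) by blast
      next
        case False
        have "coprime p (q ^ j)" using primes_coprime[OF p q] False by simp
        then obtain u v where uv: "u * p + v * q ^ j = 1"
          by (metis bezout_int coprime_imp_gcd_eq_1)
        obtain z where z: "z \<in> carrier G" "a = z [^] q ^ j" using a q unfolding D_def by blast
        have "c = c [^] (p * u + q ^ j * v)" using c(1) uv by (simp add: mult.commute)
        also have "\<dots> = (c [^] p) [^] u \<otimes> (c [^] v) [^] q ^ j"
          using c(1) by (simp add: int_pow_mult int_pow_pow mult.commute)
        also have "\<dots> = (z [^] u \<otimes> c [^] v) [^] q ^ j"
          using c(1) z by (simp add: c(2) int_pow_distrib int_pow_pow mult.commute)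
        finally have "c = (z [^] u \<otimes> c [^] v) [^] q ^ j" .
        then show ?thesis using c(1) z(1) by blast
      qed
    qed
    then show "\<exists>y\<in>D. y [^] p = a" using c(2) by blast
  qed
  then have "D = {\<one>}" using red by (simp add: reduced_group_def)
  moreover have "x \<in> D" using x pow by (auto simp: D_def)
  ultimately show ?thesis by blast
qed

lemma ScoH_exponent_imp_SH_exponent:
  assumes red: "reduced_group G" and scoh: "strongly_co_Hopfian G"
    and \<phi>: "\<phi> \<in> hom G G" and n: "ScoH_exponent G \<phi> n"
  shows "SH_exponent G \<phi> n"
proof -
  have img_sub: "subgroup ((\<phi> ^^ n) ` carrier G) G"
  proof -
    interpret h: group_hom G G "\<phi> ^^ n" by unfold_locales (rule funpow_hom[OF \<phi>])
    show ?thesis by (rule h.img_is_subgroup)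
  qed
  have ker: "x = \<one>" if x: "x \<in> (\<phi> ^^ n) ` carrier G" and x1: "\<phi> x = \<one>" for x
  proof (rule reduced_common_prime_powers_trivial[OF red scoh])
    show xc: "x \<in> carrier G" using subgroup.mem_carrier[OF img_sub x] .
    fix p :: int and j :: nat assume p: "prime p"
    obtain k where k: "\<And>x j. x \<in> carrier G \<Longrightarrow> \<exists>y\<in>carrier G. x [^] p ^ k = y [^] p ^ (k + j)"
      using strongly_co_Hopfian_powers_stabilize[OF scoh, of p] by blast
    have div: "\<exists>y\<in>carrier G. x [^] p ^ k = (y [^] p ^ k) [^] p ^ k" if x: "x \<in> carrier G" for x
    proof -
      obtain y where "y \<in> carrier G" "x [^] p ^ k = y [^] p ^ (k + k)" using k[OF x] by blast
      then show ?thesis by (intro bexI[of _ y]) (auto simp: int_pow_pow power_add)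
    qed
    show "\<exists>y\<in>carrier G. x = y [^] p ^ j"
    proof (rule exists_torsion_projection[OF div reduced_no_torsion_in_stable_power[OF red p k]])
      fix \<pi> assume \<pi>: "\<pi> \<in> hom G G" "\<And>x. x \<in> carrier G \<Longrightarrow> \<pi> x [^] p ^ k = \<one>"
        "\<And>x. x \<in> carrier G \<Longrightarrow> x [^] p ^ k = \<one> \<Longrightarrow> \<pi> x = x"
        and \<pi>_ker: "\<And>x. x \<in> carrier G \<Longrightarrow> \<pi> x = \<one> \<Longrightarrow> \<exists>y\<in>carrier G. x = y [^] p ^ k"
        and comm: "\<And>\<phi> x. \<phi> \<in> hom G G \<Longrightarrow> x \<in> carrier G \<Longrightarrow> \<pi> (\<phi> x) = \<phi> (\<pi> x)"
      have \<pi>1: "\<pi> \<one> = \<one>" and \<phi>1: "\<phi> \<one> = \<one>"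
        using hom_one[OF _ is_group is_group] \<pi>(1) \<phi> by auto
      have inj: "inj_on \<phi> (\<pi> ` (\<phi> ^^ n) ` carrier G)"
        by (rule stable_image_torsion_injective[OF scoh p \<pi> \<phi> comm[OF \<phi>] n])
      have "\<one> \<in> \<pi> ` (\<phi> ^^ n) ` carrier G"
        using subgroup.one_closed[OF img_sub] \<pi>1 by (metis imageI)
      moreover have "\<phi> (\<pi> x) = \<phi> \<one>" using comm[OF \<phi> xc] x1 \<pi>1 \<phi>1 by simp
      ultimately have "\<pi> x = \<one>" using inj x by (metis imageI inj_onD)
      then obtain y where y: "y \<in> carrier G" "x = y [^] p ^ k" using \<pi>_ker xc by blast
      then obtain z where z: "z \<in> carrier G" "x = z [^] p ^ (k + j)" using k by blast
      then have "x = (z [^] p ^ k) [^] p ^ j" by (simp add: int_pow_pow power_add)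
      then show ?thesis using z(1) by blast
    qed
  qed
  have "inj_on \<phi> ((\<phi> ^^ n) ` carrier G)"
  proof (rule inj_onI)
    fix x y assume x: "x \<in> (\<phi> ^^ n) ` carrier G" and y: "y \<in> (\<phi> ^^ n) ` carrier G" and eq: "\<phi> x = \<phi> y"
    interpret \<phi>: group_hom G G \<phi> by unfold_locales (rule \<phi>)
    have c: "x \<in> carrier G" "y \<in> carrier G" using x y subgroup.mem_carrier[OF img_sub] by auto
    have "x \<otimes> inv y \<in> (\<phi> ^^ n) ` carrier G"
      using subgroup.m_closed[OF img_sub x subgroup.m_inv_closed[OF img_sub y]] .
    moreover have "\<phi> (x \<otimes> inv y) = \<one>" using c eq by simp
    ultimately have "x \<otimes> inv y = \<one>" by (rule ker)
    then show "x = y" using c by (metis inv_closed inv_equality inv_inv)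
  qed
  then show ?thesis using n by (simp add: SH_exponent_def ScoH_exponent_def)
qed

end

section \<open>Strongly co-Hopfian implies strongly Hopfian\<close>

theorem theorem2p14:
  fixes G :: "('a, 'b) monoid_scheme"
  assumes "comm_group G"
    and "reduced_group G"
  shows "(strongly_co_Hopfian G \<longrightarrow> strongly_Hopfian G) \<and>
         (uniformly_strongly_co_Hopfian G \<longrightarrow> uniformly_strongly_Hopfian G)"
proof -
  interpret comm_group G by fact
  have SH: "SH_exponent G \<phi> n"
    if "strongly_co_Hopfian G" "\<phi> \<in> hom G G" "ScoH_exponent G \<phi> n" for \<phi> n
    using assms(2) that by (rule ScoH_exponent_imp_SH_exponent)
  have "strongly_co_Hopfian G" if "uniformly_strongly_co_Hopfian G"
    using that by (auto simp: strongly_co_Hopfian_def uniformly_strongly_co_Hopfian_def)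
  then show ?thesis
    using SH unfolding strongly_co_Hopfian_def strongly_Hopfian_def
      uniformly_strongly_co_Hopfian_def uniformly_strongly_Hopfian_def by metis
qed

end
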